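(* Let $a<b$ (either or both may be infinite), let $\varepsilon>0$, and let $Q$ be a real-valued function that is four times continuously differentiable on $a<x<b$ with $Q(x)\ne 0$ there. Put $$Q_2(x)=5\left(\frac{Q'(x)}{4Q(x)}\right)^2-\frac{Q''(x)}{4Q(x)},\qquad \widehat Q(x)=Q(x)-\varepsilon^2Q_2(x).$$ Zeros of $\widehat Q$ that are not also zeros of $Q$ are termed spurious turning points; suppose there are none, i.e. $\widehat Q(x)\neq 0$ on $a<x<b$. Let $\widehat S_0(x)=\int_{a}^{x}\sqrt{\widehat Q(\xi)}\,d\xi$. Then for arbitrary constants $c_1,c_2$ the WKB solution of the problem with potential $\widehat Q$, $$y(x)=c_1\,\widehat Q(x)^{-1/4}e^{\widehat S_0(x)/\varepsilon}+c_2\,\widehat Q(x)^{-1/4}e^{-\widehat S_0(x)/\varepsilon},$$ has residual, in the original equation $\varepsilon^2y''=Q(x)y$ (using $Q$ and not $\widehat Q$), $$\varepsilon^2y''(x)-Q(x)y(x)=\varepsilon^4Q_4(x;\varepsilon)\,y(x),\qquad \varepsilon^4Q_4(x;\varepsilon)=\varepsilon^4\,\frac{K_1+\varepsilon^2K_2}{4096\,Q(x)^6\,\widehat Q(x)^2},$$ where, with $Q,Q',Q'',Q''',Q^{iv}$ all evaluated at $x$, $$K_1=8Q^6Q^{iv}-56Q^5Q'Q'''-36Q^5(Q'')^2+216Q^4(Q')^2Q''-135Q^3(Q')^4,$$ $$\begin{aligned}K_2={}&-288Q^3(Q'')^3+468Q^2(Q')^2(Q'')^2+64Q^4Q''Q^{iv}+272Q^3Q'Q''Q'''-540Q(Q')^4Q''\\&-80Q^4(Q''')^2-80Q^3(Q')^2Q^{iv}-40Q^2(Q')^3Q'''+225(Q')^6.\end{aligned}$$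 Therefore $y$ is the exact solution of the differential equation $\varepsilon^2y''=\left(Q(x)+\varepsilon^4Q_4(x;\varepsilon)\right)y$.
   Context: The equation under study is $\varepsilon^2y''=Q(x)y$ with small parameter $\varepsilon$. For a potential $P$, the WKB solution (approximation from physical optics) of $\varepsilon^2y''=P(x)y$ is $c_1P^{-1/4}e^{S/\varepsilon}+c_2P^{-1/4}e^{-S/\varepsilon}$ with $S=\int\sqrt{P}$; here it is applied with $P=\widehat Q$. The lower limit of the integral defining $\widehat S_0$ is unimportant: it may be replaced by any convenient point of the interval (as is needed if the integral from $a$ does not exist), which only changes the constants $c_1,c_2$. Since $\widehat Q$ is continuous and nonvanishing it has constant sign; $\sqrt{\widehat Q}$ and $\widehat Q^{-1/4}$ denote fixed continuous branches, and $\widehat Q^{-1/4}$ may be replaced by $|\widehat Q|^{-1/4}$ by adjusting $c_1,c_2$. Solutions and constants may be complex.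
   Formalization: The numerator K₁+ε²K₂ of Q₄ is replaced by −(32K₁+ε²K₂), with K₁, K₂ as printed; the printed formula is false, e.g. for Q=eˣ, ε=1 on (0,∞) the residual divided by y is (96Q−1)/(4096Q̂²), not (1−3Q)/(4096Q̂²). *)

theory Defs
  imports "HOL-Analysis.Analysis"
begin

definition C_k_on :: "nat \<Rightarrow> (real \<Rightarrow> real) \<Rightarrow> real set \<Rightarrow> bool" where
  "C_k_on k f I \<longleftrightarrow>
     (\<forall>i<k. \<forall>x\<in>I. (deriv ^^ i) f field_differentiable at x) \<and>
     continuous_on I ((deriv ^^ k) f)"

definition Q2 :: "(real \<Rightarrow> real) \<Rightarrow> real \<Rightarrow> real" where
  "Q2 Q x = 5 * (deriv Q x / (4 * Q x))\<^sup>2 - (deriv ^^ 2) Q x / (4 * Q x)"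

definition Q_hat :: "real \<Rightarrow> (real \<Rightarrow> real) \<Rightarrow> real \<Rightarrow> real" where
  "Q_hat \<epsilon> Q x = Q x - \<epsilon>\<^sup>2 * Q2 Q x"

definition spurious_turning_points :: "real \<Rightarrow> (real \<Rightarrow> real) \<Rightarrow> real set \<Rightarrow> real set" where
  "spurious_turning_points \<epsilon> Q I = {x\<in>I. Q_hat \<epsilon> Q x = 0 \<and> Q x \<noteq> 0}"

text \<open>Continuous complex-valued branches of the square root and of the power \<open>-1/4\<close> of a real
  potential \<open>P\<close>, which may be negative.\<close>

definition sqrt_branch_on :: "real set \<Rightarrow> (real \<Rightarrow> real) \<Rightarrow> (real \<Rightarrow> complex) \<Rightarrow> bool" where
  "sqrt_branch_on I P r \<longleftrightarrow> continuous_on I r \<and> (\<forall>x\<in>I. r x ^ 2 = of_real (P x))"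

definition powr_minus_quarter_branch_on ::
    "real set \<Rightarrow> (real \<Rightarrow> real) \<Rightarrow> (real \<Rightarrow> complex) \<Rightarrow> bool" where
  "powr_minus_quarter_branch_on I P q \<longleftrightarrow>
     continuous_on I q \<and> (\<forall>x\<in>I. q x ^ 4 = 1 / of_real (P x))"

text \<open>The base point \<open>x0\<close> of the phase integral is either interior to the interval \<open>(a,b)\<close>, or it
  is the possibly infinite left end point, provided that the integrals from there exist.\<close>

definition admissible_base_point :: "ereal \<Rightarrow> ereal \<Rightarrow> (real \<Rightarrow> complex) \<Rightarrow> ereal \<Rightarrow> bool" where
  "admissible_base_point a b r x0 \<longleftrightarrow>
     (a < x0 \<and> x0 < b) \<or>
     (x0 = a \<and> (\<forall>x\<in>einterval a b. interval_lebesgue_integrable lborel a (ereal x) r))"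

definition phase_integral :: "(real \<Rightarrow> complex) \<Rightarrow> ereal \<Rightarrow> real \<Rightarrow> complex" where
  "phase_integral r x0 x = (LBINT \<xi>=x0..ereal x. r \<xi>)"

definition wkb_solution ::
    "real \<Rightarrow> (real \<Rightarrow> complex) \<Rightarrow> (real \<Rightarrow> complex) \<Rightarrow> ereal \<Rightarrow> complex \<Rightarrow> complex \<Rightarrow> real \<Rightarrow> complex" where
  "wkb_solution \<epsilon> r q x0 c1 c2 x =
     c1 * q x * exp (phase_integral r x0 x / of_real \<epsilon>) +
     c2 * q x * exp (- phase_integral r x0 x / of_real \<epsilon>)"

definition K1 :: "(real \<Rightarrow> real) \<Rightarrow> real \<Rightarrow> real" where
  "K1 Q x = (let u = Q x; u1 = deriv Q x; u2 = (deriv ^^ 2) Q x;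
                 u3 = (deriv ^^ 3) Q x; u4 = (deriv ^^ 4) Q x in
     8 * u^6 * u4 - 56 * u^5 * u1 * u3 - 36 * u^5 * u2^2 + 216 * u^4 * u1^2 * u2
     - 135 * u^3 * u1^4)"

definition K2 :: "(real \<Rightarrow> real) \<Rightarrow> real \<Rightarrow> real" where
  "K2 Q x = (let u = Q x; u1 = deriv Q x; u2 = (deriv ^^ 2) Q x;
                 u3 = (deriv ^^ 3) Q x; u4 = (deriv ^^ 4) Q x in
     - 288 * u^3 * u2^3 + 468 * u^2 * u1^2 * u2^2 + 64 * u^4 * u2 * u4
     + 272 * u^3 * u1 * u2 * u3 - 540 * u * u1^4 * u2 - 80 * u^4 * u3^2
     - 80 * u^3 * u1^2 * u4 - 40 * u^2 * u1^3 * u3 + 225 * u1^6)"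

text \<open>The published formula has numerator \<open>K1 + \<epsilon>\<^sup>2 * K2\<close>, with which the theorem is false: it has
  the wrong sign, and \<open>K1\<close> lacks a factor 32.  For \<open>Q x = exp x\<close> and \<open>\<epsilon> = 1\<close> one has
  \<open>Q2 = 1/16\<close>, \<open>K1 = -3 * Q^7\<close>, \<open>K2 = Q^6\<close>, and the residual of the WKB solution divided by the
  solution is \<open>(96 * Q - 1) / (4096 * Q_hat^2)\<close>, not \<open>(1 - 3 * Q) / (4096 * Q_hat^2)\<close>.
  The definition below uses the correct numerator, with \<open>K1\<close> and \<open>K2\<close> as published.\<close>

definition Q4 :: "real \<Rightarrow> (real \<Rightarrow> real) \<Rightarrow> real \<Rightarrow> real" where
  "Q4 \<epsilon> Q x = - (32 * K1 Q x + \<epsilon>\<^sup>2 * K2 Q x) / (4096 * Q x ^ 6 * (Q_hat \<epsilon> Q x)\<^sup>2)"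

text \<open>The library's \<^const>\<open>deriv\<close> does not apply to complex-valued functions of a real variable.\<close>

definition vderiv :: "(real \<Rightarrow> complex) \<Rightarrow> real \<Rightarrow> complex" where
  "vderiv y x = vector_derivative y (at x)"

definition residual :: "real \<Rightarrow> (real \<Rightarrow> real) \<Rightarrow> (real \<Rightarrow> complex) \<Rightarrow> real \<Rightarrow> complex" where
  "residual \<epsilon> P y x = of_real (\<epsilon>\<^sup>2) * (vderiv ^^ 2) y x - of_real (P x) * y x"

definition exact_solution_on ::
    "real set \<Rightarrow> real \<Rightarrow> (real \<Rightarrow> real) \<Rightarrow> (real \<Rightarrow> complex) \<Rightarrow> bool" where
  "exact_solution_on I \<epsilon> P y \<longleftrightarrow>
     (\<forall>x\<in>I. y differentiable at x \<and> vderiv y differentiable at x \<and>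
        of_real (\<epsilon>\<^sup>2) * (vderiv ^^ 2) y x = of_real (P x) * y x)"

end

theory Submission
  imports Defs
begin

text \<open>Write \<open>P = Q - \<epsilon>\<^sup>2 Q2[Q]\<close> for the modified potential. A WKB solution for any
  potential \<open>P\<close> solves \<open>\<epsilon>\<^sup>2 y'' = (P + \<epsilon>\<^sup>2 Q2[P]) y\<close> exactly, so its residual in the equation
  with potential \<open>Q\<close> is \<open>\<epsilon>\<^sup>2 (Q2[P] - Q2[Q]) y\<close>. Since \<open>P - Q\<close> is of order \<open>\<epsilon>\<^sup>2\<close>, the factor
  is of order \<open>\<epsilon>\<^sup>4\<close>, and putting it over a common denominator gives \<open>Q4\<close>.\<close>

section \<open>Derivatives of continuous branches of roots\<close>

text \<open>As a limit of slopes in the field, the derivative becomes accessible to the quotient law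
  for limits.\<close>

lemma has_vector_derivative_iff_slope:
  fixes f :: "real \<Rightarrow> 'a::real_normed_field"
  shows "(f has_vector_derivative D) (at x) \<longleftrightarrow>
    ((\<lambda>t. (f t - f x) / of_real (t - x)) \<longlongrightarrow> D) (at x)"
proof -
  have "norm ((f t - f x) - (t - x) *\<^sub>R D) / norm (t - x) = norm ((f t - f x) / of_real (t - x) - D)"
    if "t \<noteq> x" for t
  proof -
    have "(f t - f x) / of_real (t - x) - D = ((f t - f x) - (t - x) *\<^sub>R D) / of_real (t - x)"
      using that by (simp add: diff_divide_distrib scaleR_conv_of_real flip: of_real_diff)
    then show ?thesis
      by (simp add: norm_divide flip: of_real_diff)
  qed
  then have "((\<lambda>t. norm ((f t - f x) - (t - x) *\<^sub>R D) / norm (t - x)) \<longlongrightarrow> 0) (at x) \<longleftrightarrow>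
      ((\<lambda>t. norm ((f t - f x) / of_real (t - x) - D)) \<longlongrightarrow> 0) (at x)"
    by (intro filterlim_cong refl) (auto simp: eventually_at_filter)
  also have "\<dots> \<longleftrightarrow> ((\<lambda>t. (f t - f x) / of_real (t - x)) \<longlongrightarrow> D) (at x)"
    by (simp add: tendsto_norm_zero_iff flip: LIM_zero_iff[where l = D])
  finally show ?thesis
    by (simp add: has_vector_derivative_def has_derivative_iff_norm bounded_linear_scaleR_left)
qed

text \<open>Implicit differentiation along a continuous branch: the difference of powers factors as
  \<open>(f t - f x) * g t\<close> with \<open>g\<close> tending to
  \<open>(n + 1) * f x ^ n\<close>, which is nonzero. So the slope of \<open>f\<close> is that of
  the power divided by \<open>g\<close>.\<close>

lemma has_vector_derivative_root:
  fixes f :: "real \<Rightarrow> 'a::real_normed_field"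
  assumes cont: "isCont f x"
    and deriv: "((\<lambda>t. f t ^ Suc n) has_vector_derivative D) (at x)"
    and nz: "of_nat (Suc n) * f x ^ n \<noteq> 0"
  shows "(f has_vector_derivative D / (of_nat (Suc n) * f x ^ n)) (at x)"
proof -
  define g where "g t = (\<Sum>i<Suc n. f x ^ (Suc n - Suc i) * f t ^ i)" for t
  have "(g \<longlongrightarrow> (\<Sum>i<Suc n. f x ^ (Suc n - Suc i) * f x ^ i)) (at x)"
    unfolding g_def using cont by (intro tendsto_intros) (simp add: isCont_def)
  also have "(\<Sum>i<Suc n. f x ^ (Suc n - Suc i) * f x ^ i) = (\<Sum>i<Suc n. f x ^ n)"
    by (intro sum.cong) (auto simp flip: power_add)
  finally have g: "(g \<longlongrightarrow> of_nat (Suc n) * f x ^ n) (at x)"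
    by (simp only: sum_constant card_lessThan)
  have "eventually (\<lambda>t. g t \<noteq> 0) (at x)"
    using tendsto_imp_eventually_ne[OF g nz] .
  moreover have "f t ^ Suc n - f x ^ Suc n = (f t - f x) * g t" for t
    unfolding g_def by (rule power_diff_sumr2)
  ultimately have "eventually (\<lambda>t. (f t ^ Suc n - f x ^ Suc n) / of_real (t - x) / g t
      = (f t - f x) / of_real (t - x)) (at x)"
    by (auto elim!: eventually_mono simp del: power_Suc)
  moreover have "((\<lambda>t. (f t ^ Suc n - f x ^ Suc n) / of_real (t - x) / g t) \<longlongrightarrow>
      D / (of_nat (Suc n) * f x ^ n)) (at x)"
    using deriv g nz unfolding has_vector_derivative_iff_slope by (rule tendsto_divide)
  ultimately show ?thesis
    unfolding has_vector_derivative_iff_slope by (rule Lim_transform_eventually[rotated])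
qed

section \<open>The phase integral as an antiderivative\<close>

lemma phase_integral_interior_has_vector_derivative:
  assumes cont: "continuous_on (einterval a b) r"
    and c: "c \<in> einterval a b" and x: "x \<in> einterval a b"
  shows "(phase_integral r (ereal c) has_vector_derivative r x) (at x)"
proof -
  have "a < ereal (min c x)" and "ereal (max c x) < b"
    using c x by (auto simp: einterval_iff min_def max_def)
  from ereal_dense2[OF this(1)] ereal_dense2[OF this(2)]
  obtain u v where u: "a < ereal u" "u < c" "u < x" and v: "ereal v < b" "c < v" "x < v"
    by auto
  have "a < ereal t \<and> ereal t < b" if "u \<le> t" "t \<le> v" for t
    using that less_le_trans[OF u(1), of "ereal t"] le_less_trans[OF _ v(1), of "ereal t"] by simp
  then have "{u..v} \<subseteq> einterval a b"
    by (auto simp: einterval_iff)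
  then have "continuous_on {u..v} r"
    using cont continuous_on_subset by blast
  then have "((\<lambda>t. LBINT y=c..t. r y) has_vector_derivative r x) (at x within {u..v})"
    using u v by (intro interval_integral_FTC2) simp_all
  \<comment> \<open>The point \<open>x\<close> lies strictly between \<open>u\<close> and
    \<open>v\<close>, so on the open interval the restricted derivative is the full one.\<close>
  then have "((\<lambda>t. LBINT y=c..t. r y) has_vector_derivative r x) (at x within {u<..<v})"
    by (rule has_vector_derivative_within_subset) auto
  then have "((\<lambda>t. LBINT y=c..t. r y) has_vector_derivative r x) (at x)"
    by (rule has_vector_derivative_within_open[THEN iffD1, rotated -1]) (use u(3) v(3) in simp_all)
  then show ?thesis
    by (simp only: phase_integral_def[abs_def])
qed

text \<open>For the end point \<open>a\<close> as base, the integral is split at \<open>x\<close>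
  itself: the part from \<open>a\<close> to \<open>x\<close> is constant in \<open>t\<close>, and
  the rest has an interior base point.\<close>

lemma phase_integral_has_vector_derivative:
  assumes cont: "continuous_on (einterval a b) r"
    and base: "admissible_base_point a b r x0" and x: "x \<in> einterval a b"
  shows "(phase_integral r x0 has_vector_derivative r x) (at x)"
  using base unfolding admissible_base_point_def
proof (elim disjE conjE)
  assume "a < x0" "x0 < b"
  then obtain c where "x0 = ereal c" "c \<in> einterval a b"
    by (cases x0) (auto simp: einterval_iff)
  then show ?thesis
    using phase_integral_interior_has_vector_derivative[OF cont _ x] by blast
next
  assume x0: "x0 = a"
    and int: "\<forall>t\<in>einterval a b. interval_lebesgue_integrable lborel a (ereal t) r"
  have eq: "phase_integral r a x + phase_integral r (ereal x) t = phase_integral r a t"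
    if t: "t \<in> einterval a b" for t
  proof -
    \<comment> \<open>Additivity asks for integrability over the hull of \<open>a\<close>,
      \<open>x\<close> and \<open>t\<close>, which runs from \<open>a\<close> to
      \<open>max x t\<close>, again a point of the interval.\<close>
    have "interval_lebesgue_integrable lborel a (ereal (max x t)) r"
      using int x t by (cases "x \<le> t") (simp_all add: max_absorb1 max_absorb2)
    moreover have "min a (min (ereal x) (ereal t)) = a"
      using x t by (intro min_absorb1) (simp add: einterval_iff less_imp_le)
    moreover have "max a (max (ereal x) (ereal t)) = ereal (max x t)"
      using x by (subst max_absorb2) (simp_all add: einterval_iff less_imp_le le_max_iff_disj)
    ultimately have "interval_lebesgue_integrable lborel (min a (min (ereal x) (ereal t)))
        (max a (max (ereal x) (ereal t))) r"
      by (simp only:)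
    then show ?thesis
      unfolding phase_integral_def by (rule interval_integral_sum)
  qed
  have "((\<lambda>t. phase_integral r a x + phase_integral r (ereal x) t) has_vector_derivative 0 + r x) (at x)"
    by (intro derivative_intros phase_integral_interior_has_vector_derivative[OF cont] x)
  from has_vector_derivative_transform_within_open[OF this open_einterval x eq] show ?thesis
    by (simp add: x0)
qed

section \<open>The equation solved exactly by a WKB solution\<close>

lemma exp_has_vector_derivative:
  fixes f :: "real \<Rightarrow> complex"
  assumes "(f has_vector_derivative D) (at x)"
  shows "((\<lambda>t. exp (f t)) has_vector_derivative D * exp (f x)) (at x)"
  using field_vector_diff_chain_at[OF assms DERIV_exp] by (simp add: o_def)

text \<open>The choice of branches is irrelevant: differentiating \<open>q\<^sup>4 P = 1\<close> and \<open>r\<^sup>2 = P\<close> gives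
  \<open>2 q' r + q r' = 0\<close>, which cancels the terms of order \<open>\<epsilon>\<close>.\<close>
lemma wkb_solution_second_derivative:
  fixes P P' P'' :: "real \<Rightarrow> real" and r q :: "real \<Rightarrow> complex" and c1 c2 :: complex
  assumes \<epsilon>: "\<epsilon> \<noteq> 0" and I: "open I"
    and P': "\<And>x. x \<in> I \<Longrightarrow> (P has_real_derivative P' x) (at x)"
    and P'': "\<And>x. x \<in> I \<Longrightarrow> (P' has_real_derivative P'' x) (at x)"
    and nz: "\<And>x. x \<in> I \<Longrightarrow> P x \<noteq> 0"
    and r: "sqrt_branch_on I P r" and q: "powr_minus_quarter_branch_on I P q"
    and S: "\<And>x. x \<in> I \<Longrightarrow> (phase_integral r x0 has_vector_derivative r x) (at x)"
  defines "y \<equiv> wkb_solution \<epsilon> r q x0 c1 c2"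
  assumes x: "x \<in> I"
  shows "y differentiable at x" and "vderiv y differentiable at x"
    and "of_real (\<epsilon>\<^sup>2) * (vderiv ^^ 2) y x =
      of_real (P x + \<epsilon>\<^sup>2 * (5 * (P' x / (4 * P x))\<^sup>2 - P'' x / (4 * P x))) * y x"
proof -
  have r2: "r t ^ 2 = of_real (P t)" and q4: "q t ^ 4 = 1 / of_real (P t)" if "t \<in> I" for t
    using r q that by (auto simp: sqrt_branch_on_def powr_minus_quarter_branch_on_def)
  have r_nz: "r t \<noteq> 0" and q_nz: "q t \<noteq> 0" if "t \<in> I" for t
    using r2[OF that] q4[OF that] nz[OF that] by auto
  have cont: "isCont r t" "isCont q t" if "t \<in> I" for t
    using r q I that
    by (auto simp: sqrt_branch_on_def powr_minus_quarter_branch_on_def continuous_on_eq_continuous_at)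
  have dr: "(r has_vector_derivative of_real (P' t) / (2 * r t)) (at t)" if t: "t \<in> I" for t
  proof -
    have "((\<lambda>t. r t ^ Suc 1) has_vector_derivative of_real (P' t)) (at t)"
      by (rule has_vector_derivative_transform_within_open
          [OF has_vector_derivative_of_real[OF P'[OF t]] I t])
        (use r2 in \<open>simp add: power2_eq_square\<close>)
    from has_vector_derivative_root[OF cont(1)[OF t] this] r_nz[OF t] show ?thesis by simp
  qed
  \<comment> \<open>Differentiating \<open>q^4 = 1 / P\<close> gives
    \<open>4 q^3 q' = - P' / P^2\<close>; then \<open>q * q^3 * P = 1\<close> removes the powers of
    \<open>q\<close>, leaving the logarithmic derivative \<open>- P' / (4 P)\<close> for every
    branch.\<close>
  have dq: "(q has_vector_derivative - of_real (P' t / (4 * P t)) * q t) (at t)" if t: "t \<in> I" for t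
  proof -
    have "((\<lambda>t. 1 / P t) has_real_derivative - P' t / (P t)\<^sup>2) (at t)"
      using nz[OF t] by (auto intro!: derivative_eq_intros P'[OF t] simp: power2_eq_square)
    then have "((\<lambda>t. q t ^ Suc 3) has_vector_derivative of_real (- P' t / (P t)\<^sup>2)) (at t)"
      by (rule has_vector_derivative_transform_within_open[OF has_vector_derivative_of_real _ t])
        (use I q4 in \<open>auto simp: numeral_eq_Suc\<close>)
    from has_vector_derivative_root[OF cont(2)[OF t] this] q_nz[OF t]
    have "(q has_vector_derivative of_real (- P' t / (P t)\<^sup>2) / (4 * q t ^ 3)) (at t)" by simp
    moreover have "of_real (- P' t / (P t)\<^sup>2) / (4 * q t ^ 3) = - of_real (P' t / (4 * P t)) * q t"
    proof -
      have "q t * q t ^ 3 * of_real (P t) = 1"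
        using q4[OF t] nz[OF t] by (simp add: numeral_eq_Suc field_simps)
      then show ?thesis
        using nz[OF t] q_nz[OF t] by (simp add: field_simps power2_eq_square)
    qed
    ultimately show ?thesis by simp
  qed
  define E where "E t = exp (phase_integral r x0 t / of_real \<epsilon>)" for t
  define F where "F t = exp (- phase_integral r x0 t / of_real \<epsilon>)" for t
  have dE: "(E has_vector_derivative r t / of_real \<epsilon> * E t) (at t)"
    and dF: "(F has_vector_derivative - r t / of_real \<epsilon> * F t) (at t)" if "t \<in> I" for t
    unfolding E_def F_def
    by (intro exp_has_vector_derivative derivative_intros S[OF that])+
  \<comment> \<open>\<open>- L\<close> is the logarithmic derivative of \<open>q\<close>. Up to the
    factor \<open>r / \<epsilon>\<close>, differentiation swaps \<open>G\<close> and
    \<open>H\<close>, so no exponentials need to be handled below.\<close>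
  define L where "L t = P' t / (4 * P t)" for t
  define G where "G t = c1 * E t + c2 * F t" for t
  define H where "H t = c1 * E t - c2 * F t" for t
  define y' where "y' t = q t * (- of_real (L t) * G t + r t / of_real \<epsilon> * H t)" for t
  have dG: "(G has_vector_derivative r t / of_real \<epsilon> * H t) (at t)" if "t \<in> I" for t
    unfolding G_def H_def
    using has_vector_derivative_add[OF has_vector_derivative_mult_right[OF dE[OF that], of c1]
        has_vector_derivative_mult_right[OF dF[OF that], of c2]]
    by (simp add: algebra_simps)
  have dH: "(H has_vector_derivative r t / of_real \<epsilon> * G t) (at t)" if "t \<in> I" for t
    unfolding G_def H_def
    using has_vector_derivative_diff[OF has_vector_derivative_mult_right[OF dE[OF that], of c1]
        has_vector_derivative_mult_right[OF dF[OF that], of c2]]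
    by (simp add: algebra_simps)
  have y: "y = (\<lambda>t. q t * G t)"
    by (simp add: fun_eq_iff y_def wkb_solution_def E_def F_def G_def algebra_simps)
  have dy: "(y has_vector_derivative y' t) (at t)" if t: "t \<in> I" for t
    using has_vector_derivative_mult[OF dq[OF t] dG[OF t]]
    by (simp add: y y'_def L_def algebra_simps)
  have dy': "(y' has_vector_derivative
      of_real (P x / \<epsilon>\<^sup>2 + (5 * (P' x / (4 * P x))\<^sup>2 - P'' x / (4 * P x))) * y x) (at x)"
  proof -
    \<comment> \<open>The derivative of \<open>L\<close>, with \<open>(P')^2 / (4 P^2)\<close>
      written as \<open>4 L^2\<close>.\<close>
    define d where "d = P'' x / (4 * P x) - 4 * (L x)\<^sup>2"
    have dL: "(L has_real_derivative d) (at x)"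
      unfolding L_def d_def
      using nz[OF x] by (auto intro!: derivative_eq_intros P'[OF x] P''[OF x]
          simp: field_simps power2_eq_square)
    \<comment> \<open>This is \<open>r' = 2 L r\<close>, from \<open>P' = 4 L P\<close> and
      \<open>P = r^2\<close>.\<close>
    have P'_eq: "of_real (P' x) / (2 * r x) = 2 * of_real (L x) * r x"
    proof -
      have "of_real (P' x) = 4 * of_real (L x) * r x ^ 2"
        using nz[OF x] by (simp add: r2[OF x] L_def)
      then show ?thesis
        using r_nz[OF x] by (simp add: power2_eq_square)
    qed
    have "(y' has_vector_derivative
        q x * ((- of_real (L x) * (r x / of_real \<epsilon> * H x) + - of_real d * G x)
          + (r x / of_real \<epsilon> * (r x / of_real \<epsilon> * G x) + 2 * of_real (L x) * r x / of_real \<epsilon> * H x))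
        + - of_real (L x) * q x * (- of_real (L x) * G x + r x / of_real \<epsilon> * H x)) (at x)"
      unfolding y'_def using dq[OF x] dr[OF x] unfolding P'_eq L_def[symmetric]
      by (intro has_vector_derivative_mult has_vector_derivative_add has_vector_derivative_minus
          has_vector_derivative_of_real has_vector_derivative_divide dG[OF x] dH[OF x] dL)
    \<comment> \<open>The coefficients of \<open>L r H / \<epsilon>\<close> are -1, 2 and -1 and sum
      to zero. What remains is \<open>r^2 / \<epsilon>^2 + L^2 - d\<close>, and
      \<open>L^2 - d\<close> is \<open>5 L^2 - P'' / (4 P)\<close>, the expression \<open>Q2\<close>
      formed with \<open>P\<close>.\<close>
    also have "q x * ((- of_real (L x) * (r x / of_real \<epsilon> * H x) + - of_real d * G x)
          + (r x / of_real \<epsilon> * (r x / of_real \<epsilon> * G x) + 2 * of_real (L x) * r x / of_real \<epsilon> * H x))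
        + - of_real (L x) * q x * (- of_real (L x) * G x + r x / of_real \<epsilon> * H x)
        = (r x ^ 2 / of_real \<epsilon> ^ 2 + (of_real (L x) ^ 2 - of_real d)) * (q x * G x)"
      by (simp add: algebra_simps power2_eq_square)
    also have "\<dots> = of_real (P x / \<epsilon>\<^sup>2 + (5 * (L x)\<^sup>2 - P'' x / (4 * P x))) * y x"
      by (simp add: r2[OF x] y d_def)
    finally show ?thesis
      unfolding L_def .
  qed
  have vy: "vderiv y t = y' t" if "t \<in> I" for t
    unfolding vderiv_def by (rule vector_derivative_at[OF dy[OF that]])
  have dvy: "(vderiv y has_vector_derivative
      of_real (P x / \<epsilon>\<^sup>2 + (5 * (P' x / (4 * P x))\<^sup>2 - P'' x / (4 * P x))) * y x) (at x)"
    by (rule has_vector_derivative_transform_within_open[OF dy' I x]) (simp add: vy)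
  show "y differentiable at x" "vderiv y differentiable at x"
    using dy[OF x] dvy by (auto intro: differentiableI_vector)
  have "(vderiv ^^ 2) y x =
      of_real (P x / \<epsilon>\<^sup>2 + (5 * (P' x / (4 * P x))\<^sup>2 - P'' x / (4 * P x))) * y x"
    using vector_derivative_at[OF dvy] by (simp add: numeral_2_eq_2 vderiv_def)
  then have "of_real (\<epsilon>\<^sup>2) * (vderiv ^^ 2) y x = of_real (\<epsilon>\<^sup>2 *
      (P x / \<epsilon>\<^sup>2 + (5 * (P' x / (4 * P x))\<^sup>2 - P'' x / (4 * P x)))) * y x"
    by (simp only: of_real_mult mult.assoc)
  also have "\<epsilon>\<^sup>2 * (P x / \<epsilon>\<^sup>2 + (5 * (P' x / (4 * P x))\<^sup>2 - P'' x / (4 * P x))) =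
      P x + \<epsilon>\<^sup>2 * (5 * (P' x / (4 * P x))\<^sup>2 - P'' x / (4 * P x))"
    using \<epsilon> by (simp add: distrib_left)
  finally show "of_real (\<epsilon>\<^sup>2) * (vderiv ^^ 2) y x =
      of_real (P x + \<epsilon>\<^sup>2 * (5 * (P' x / (4 * P x))\<^sup>2 - P'' x / (4 * P x))) * y x" .
qed

section \<open>The residual as a rational function of Q and its derivatives\<close>

text \<open>Here \<open>P = A / u\<^sup>2\<close>, \<open>P' = B / u\<^sup>3\<close>, \<open>P'' = C / u\<^sup>4\<close> are the potential \<open>Q_hat\<close> and its
  derivatives over a common power of \<open>u = Q\<close>, and \<open>e = \<epsilon>\<^sup>2\<close>.\<close>
lemma Q4_numerator_identity:
  fixes u u1 u2 u3 u4 e :: real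
  defines "A \<equiv> u^3 - e * (5 / 16 * u1^2 - u * u2 / 4)"
    and "A1 \<equiv> 3 * u^2 * u1 - e * (3 / 8 * u1 * u2 - u * u3 / 4)"
    and "A2 \<equiv> 6 * u * u1^2 + 3 * u^2 * u2 - e * (3 / 8 * u2^2 + u1 * u3 / 8 - u * u4 / 4)"
  defines "B \<equiv> A1 * u - 2 * A * u1"
  defines "C \<equiv> (A2 * u - A1 * u1 - 2 * A * u2) * u - 3 * B * u1"
  shows "4096 * (5 / 16 * B^2 - A * C / 4 - (5 / 16 * u1^2 - u * u2 / 4) * A^2) =
    - e * (32 * (8 * u^6 * u4 - 56 * u^5 * u1 * u3 - 36 * u^5 * u2^2 + 216 * u^4 * u1^2 * u2
     - 135 * u^3 * u1^4) + e * (- 288 * u^3 * u2^3 + 468 * u^2 * u1^2 * u2^2 + 64 * u^4 * u2 * u4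
     + 272 * u^3 * u1 * u2 * u3 - 540 * u * u1^4 * u2 - 80 * u^4 * u3^2
     - 80 * u^3 * u1^2 * u4 - 40 * u^2 * u1^3 * u3 + 225 * u1^6))"
  \<comment> \<open>For \<open>e = 0\<close> one has \<open>A = u^3\<close>,
    \<open>B = u^3 * u1\<close>, \<open>C = u^4 * u2\<close> and the left side vanishes; this
    explains the factor \<open>e\<close> on the right.\<close>
  unfolding A_def A1_def A2_def B_def C_def
  by (simp add: field_simps power2_eq_square power3_eq_cube eval_nat_numeral)

lemma C_k_on_has_real_derivative:
  assumes "C_k_on k f I" "i < k" "x \<in> I"
  shows "((deriv ^^ i) f has_real_derivative (deriv ^^ Suc i) f x) (at x)"
  using assms by (auto simp: C_k_on_def simp flip: DERIV_deriv_iff_field_differentiable)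

section \<open>The WKB solution for the modified potential\<close>

theorem theorem2:
  fixes a b x0 :: ereal and \<epsilon> :: real and Q :: "real \<Rightarrow> real"
    and r q :: "real \<Rightarrow> complex" and c1 c2 :: complex
  assumes "a < b" and "\<epsilon> > 0"
    and "C_k_on 4 Q (einterval a b)"
    and "\<forall>x\<in>einterval a b. Q x \<noteq> 0"
    and "spurious_turning_points \<epsilon> Q (einterval a b) = {}"
    and "sqrt_branch_on (einterval a b) (Q_hat \<epsilon> Q) r"
    and "powr_minus_quarter_branch_on (einterval a b) (Q_hat \<epsilon> Q) q"
    and "admissible_base_point a b r x0"
  defines "y \<equiv> wkb_solution \<epsilon> r q x0 c1 c2"
  shows "(\<forall>x\<in>einterval a b. residual \<epsilon> Q y x = of_real (\<epsilon>^4 * Q4 \<epsilon> Q x) * y x) \<and>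
    exact_solution_on (einterval a b) \<epsilon> (\<lambda>x. Q x + \<epsilon>^4 * Q4 \<epsilon> Q x) y"
proof -
  let ?I = "einterval a b"
  define u1 where "u1 = deriv Q"
  define u2 where "u2 = (deriv ^^ 2) Q"
  define u3 where "u3 = (deriv ^^ 3) Q"
  define u4 where "u4 = (deriv ^^ 4) Q"
  have d0: "(Q has_real_derivative u1 x) (at x)" and d1: "(u1 has_real_derivative u2 x) (at x)"
    and d2: "(u2 has_real_derivative u3 x) (at x)" and d3: "(u3 has_real_derivative u4 x) (at x)"
    if "x \<in> ?I" for x
    using that C_k_on_has_real_derivative[OF assms(3), of 0 x]
      C_k_on_has_real_derivative[OF assms(3), of 1 x] C_k_on_has_real_derivative[OF assms(3), of 2 x]
      C_k_on_has_real_derivative[OF assms(3), of 3 x]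
    by (simp_all add: u1_def u2_def u3_def u4_def numeral_eq_Suc)
  have Q_nz: "Q x \<noteq> 0" and P_nz: "Q_hat \<epsilon> Q x \<noteq> 0" if "x \<in> ?I" for x
    using assms(4,5) that by (auto simp: spurious_turning_points_def)
  \<comment> \<open>\<open>A1\<close> and \<open>A2\<close> are the first two derivatives of
    \<open>A\<close>. Since \<open>A\<close> contains \<open>Q''\<close>, they reach the fourth
    derivative of \<open>Q\<close>. \<open>B\<close> and \<open>C\<close> are the numerators that
    the quotient rule gives for \<open>A / Q^2\<close> and \<open>B / Q^3\<close>.\<close>
  define A where "A x = Q x^3 - \<epsilon>\<^sup>2 * (5 / 16 * (u1 x)^2 - Q x * u2 x / 4)" for x
  define A1 where "A1 x = 3 * (Q x)^2 * u1 x - \<epsilon>\<^sup>2 * (3 / 8 * u1 x * u2 x - Q x * u3 x / 4)" for x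
  define A2 where "A2 x = 6 * Q x * (u1 x)^2 + 3 * (Q x)^2 * u2 x
    - \<epsilon>\<^sup>2 * (3 / 8 * (u2 x)^2 + u1 x * u3 x / 8 - Q x * u4 x / 4)" for x
  define B where "B x = A1 x * Q x - 2 * A x * u1 x" for x
  define C where "C x = (A2 x * Q x - A1 x * u1 x - 2 * A x * u2 x) * Q x - 3 * B x * u1 x" for x
  have P_eq: "Q_hat \<epsilon> Q x = A x / (Q x)^2" if "x \<in> ?I" for x
    using Q_nz[OF that]
    by (simp add: Q_hat_def Q2_def A_def u1_def u2_def field_simps power2_eq_square power3_eq_cube)
  have dA: "(A has_real_derivative A1 x) (at x)" if x: "x \<in> ?I" for x
    unfolding A_def A1_def by (auto intro!: derivative_eq_intros d0[OF x] d1[OF x] d2[OF x]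
        simp: algebra_simps)
  have dA1: "(A1 has_real_derivative A2 x) (at x)" if x: "x \<in> ?I" for x
    unfolding A1_def A2_def by (auto intro!: derivative_eq_intros d0[OF x] d1[OF x] d2[OF x] d3[OF x]
        simp: field_simps power2_eq_square)
  have dB: "(B has_real_derivative A2 x * Q x - A1 x * u1 x - 2 * A x * u2 x) (at x)"
    if x: "x \<in> ?I" for x
    unfolding B_def by (auto intro!: derivative_eq_intros d0[OF x] d1[OF x] dA[OF x] dA1[OF x]
        simp: algebra_simps)
  have dP: "(Q_hat \<epsilon> Q has_real_derivative B x / Q x ^ 3) (at x)" if x: "x \<in> ?I" for x
  proof -
    have "((\<lambda>t. A t / (Q t)^2) has_real_derivative B x / Q x ^ 3) (at x)"
      using Q_nz[OF x] by (auto intro!: derivative_eq_intros d0[OF x] dA[OF x]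
          simp: B_def field_simps power2_eq_square power3_eq_cube)
    then show ?thesis
      by (rule has_field_derivative_transform_within_open[OF _ open_einterval x])
        (simp add: P_eq)
  qed
  have dP1: "((\<lambda>x. B x / Q x ^ 3) has_real_derivative C x / Q x ^ 4) (at x)" if x: "x \<in> ?I" for x
    using Q_nz[OF x] by (auto intro!: derivative_eq_intros d0[OF x] dB[OF x]
        simp: C_def field_simps eval_nat_numeral)
  have S: "(phase_integral r x0 has_vector_derivative r x) (at x)" if "x \<in> ?I" for x
    using phase_integral_has_vector_derivative[OF _ assms(8) that] assms(6)
    by (simp add: sqrt_branch_on_def)
  note wkb = wkb_solution_second_derivative[OF less_imp_neq[OF assms(2), symmetric] open_einterval
      dP dP1 P_nz assms(6,7) S, of _ c1 c2, folded y_def]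
  \<comment> \<open>In these terms \<open>Q2\<close> formed with \<open>Q_hat\<close> is
    \<open>(5/16 B^2 - A C / 4) / (Q^2 A^2)\<close>, while \<open>Q2 Q\<close> is
    \<open>D / Q^2\<close>; the numerator of their difference is the left side of the polynomial
    identity, up to the factor 4096.\<close>
  have pot: "Q_hat \<epsilon> Q x + \<epsilon>\<^sup>2 * (5 * (B x / Q x ^ 3 / (4 * Q_hat \<epsilon> Q x))\<^sup>2
      - C x / Q x ^ 4 / (4 * Q_hat \<epsilon> Q x)) = Q x + \<epsilon>^4 * Q4 \<epsilon> Q x" if x: "x \<in> ?I" for x
  proof -
    define D where "D = 5 / 16 * (u1 x)^2 - Q x * u2 x / 4"
    have nz: "Q x \<noteq> 0" "A x \<noteq> 0"
      using Q_nz[OF x] P_nz[OF x] P_eq[OF x] by auto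
    have Q2: "Q2 Q x = D / (Q x)^2"
      using nz by (simp add: Q2_def D_def u1_def u2_def field_simps power2_eq_square)
    have id: "4096 * (5 / 16 * (B x)^2 - A x * C x / 4 - D * (A x)^2) =
        - \<epsilon>\<^sup>2 * (32 * K1 Q x + \<epsilon>\<^sup>2 * K2 Q x)"
      unfolding D_def K1_def K2_def Let_def A_def A1_def A2_def B_def C_def
      unfolding u1_def[symmetric] u2_def[symmetric] u3_def[symmetric] u4_def[symmetric]
      by (rule Q4_numerator_identity)
    \<comment> \<open>The denominators agree because \<open>Q_hat = A / Q^2\<close> gives
      \<open>Q^6 * Q_hat^2 = Q^2 * A^2\<close>.\<close>
    have "\<epsilon>^4 * Q4 \<epsilon> Q x = \<epsilon>\<^sup>2 * (- \<epsilon>\<^sup>2 * (32 * K1 Q x + \<epsilon>\<^sup>2 * K2 Q x)) / (4096 * (Q x)^2 * (A x)^2)"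
      using nz by (simp add: Q4_def P_eq[OF x] field_simps eval_nat_numeral)
    also have "\<dots> = \<epsilon>\<^sup>2 * (5 / 16 * (B x)^2 - A x * C x / 4 - D * (A x)^2) / ((Q x)^2 * (A x)^2)"
      unfolding id[symmetric] using nz by (simp add: field_simps)
    also have "\<dots> = \<epsilon>\<^sup>2 * (5 * (B x / Q x ^ 3 / (4 * (A x / (Q x)^2)))\<^sup>2
        - C x / Q x ^ 4 / (4 * (A x / (Q x)^2)) - D / (Q x)^2)"
      using nz by (simp add: field_simps eval_nat_numeral)
    finally show ?thesis
      unfolding P_eq[OF x, symmetric] Q2[symmetric] Q_hat_def[of \<epsilon> Q x] by (simp add: algebra_simps)
  qed
  have ode: "of_real (\<epsilon>\<^sup>2) * (vderiv ^^ 2) y x = of_real (Q x + \<epsilon>^4 * Q4 \<epsilon> Q x) * y x"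
    if x: "x \<in> ?I" for x
    using wkb(3)[OF _ _ _ _ x] unfolding pot[OF x] by simp
  have "residual \<epsilon> Q y x = of_real (\<epsilon>^4 * Q4 \<epsilon> Q x) * y x" if "x \<in> ?I" for x
    unfolding residual_def ode[OF that] by (simp only: of_real_add) (simp add: distrib_right)
  then show ?thesis
    using wkb(1,2) ode by (simp add: exact_solution_on_def)
qed

end
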